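(* Let $X$ be a separable infinite-dimensional complex Banach space and let $T$ be a bounded linear operator on $X$. The following assertions are equivalent: (1) for any countable subset $D$ of $\mathbb{T}$, the linear span of $\bigcup_{\lambda\in\mathbb{T}\setminus D}\ker(T-\lambda)$ is dense in $X$; (2) $T$ has a perfectly spanning set of eigenvectors associated to unimodular eigenvalues; (3) there exist a sequence $(K_i)_{i\geq 1}$ of subsets of $\mathbb{T}$ which are homeomorphic to the Cantor set $2^{\omega}$ and a sequence $(E_i)_{i\geq 1}$ of continuous functions $E_i:K_i\longrightarrow S_X$ such that: for any $i\geq 1$ and any $\lambda\in K_i$, $TE_i(\lambda)=\lambda E_i(\lambda)$; and the linear span of $\{E_i(\lambda) : i\geq 1,\ \lambda\in K_i\}$ is dense in $X$.
   Context: $\mathbb{T}=\{\lambda\in\mathbb{C} : |\lambda|=1\}$ is the unit circle and $S_X=\{x\in X : \|x\|=1\}$ is the unit sphere of $X$. A bounded operator $T$ on $X$ has a perfectly spanning set of eigenvectors associated to unimodular eigenvalues if there exists a continuous (i.e. atomless) probability measure $\sigma$ on $\mathbb{T}$ such that for every $\sigma$-measurable subset $A$ of $\mathbb{T}$ with $\sigma(A)=1$, the linear span of $\bigcup_{\lambda\in A}\ker(T-\lambda)$ is dense in $X$. *)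

theory Defs
  imports "HOL-Probability.Probability"
begin

class complex_normed_vector = real_normed_vector +
  fixes scaleC :: "complex \<Rightarrow> 'a \<Rightarrow> 'a" (infixr "*\<^sub>C" 75)
  assumes scaleC_add_right: "a *\<^sub>C (x + y) = a *\<^sub>C x + a *\<^sub>C y"
    and scaleC_add_left: "(a + b) *\<^sub>C x = a *\<^sub>C x + b *\<^sub>C x"
    and scaleC_scaleC: "a *\<^sub>C b *\<^sub>C x = (a * b) *\<^sub>C x"
    and scaleC_one: "1 *\<^sub>C x = x"
    and scaleR_scaleC: "r *\<^sub>R x = complex_of_real r *\<^sub>C x"
    and norm_scaleC: "norm (a *\<^sub>C x) = cmod a * norm x"

class complex_banach = complex_normed_vector + banach

text \<open>The library's \<^const>\<open>span\<close> is the real span; \<open>cspan\<close> is the complex one.\<close>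

global_interpretation complex_vector:
  vector_space "scaleC :: complex \<Rightarrow> 'a \<Rightarrow> 'a::complex_normed_vector"
  defines cspan = complex_vector.span
  by unfold_locales (rule scaleC_add_right scaleC_add_left scaleC_scaleC scaleC_one)+

definition bounded_clinear ::
    "('a::complex_normed_vector \<Rightarrow> 'b::complex_normed_vector) \<Rightarrow> bool" where
  "bounded_clinear T \<longleftrightarrow>
     Vector_Spaces.linear scaleC scaleC T \<and> (\<exists>M. \<forall>x. norm (T x) \<le> M * norm x)"

definition infinite_cdim :: "'a::complex_normed_vector itself \<Rightarrow> bool" where
  "infinite_cdim _ \<longleftrightarrow> \<not> (\<exists>B :: 'a set. finite B \<and> cspan B = UNIV)"

abbreviation unit_circle :: "complex set" where
  "unit_circle \<equiv> sphere 0 1"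

definition eigenspace :: "('a::complex_normed_vector \<Rightarrow> 'a) \<Rightarrow> complex \<Rightarrow> 'a set" where
  "eigenspace T \<mu> = {x. T x - \<mu> *\<^sub>C x = 0}"

definition continuous_circle_measure :: "complex measure \<Rightarrow> bool" where
  "continuous_circle_measure \<sigma> \<longleftrightarrow>
     prob_space \<sigma> \<and> sets \<sigma> = sets (restrict_space borel unit_circle) \<and>
     (\<forall>\<mu>\<in>unit_circle. emeasure \<sigma> {\<mu>} = 0)"

text \<open>The measure is a Borel measure on the circle; its \<open>\<sigma>\<close>-measurable sets are those of its
  completion.\<close>

definition perfectly_spanning :: "('a::complex_normed_vector \<Rightarrow> 'a) \<Rightarrow> bool" where
  "perfectly_spanning T \<longleftrightarrow>
     (\<exists>\<sigma>. continuous_circle_measure \<sigma> \<and>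
        (\<forall>A\<in>sets (completion \<sigma>). emeasure (completion \<sigma>) A = 1 \<longrightarrow>
           closure (cspan (\<Union>\<mu>\<in>A. eigenspace T \<mu>)) = UNIV))"

end

theory Submission
  imports Defs
begin

text \<open>The equivalence is proved as a cycle. A continuous measure gives mass 0 to countable sets, so a
perfectly spanning set of eigenvectors stays spanning when countably many eigenvalues are dropped
(\<open>perfectly_spanning_imp_countably_robust\<close>).

From Cantor sets to measures: each Cantor set carries an image of the coin tossing measure, which is
atomless and charges every nonempty relatively open subset. A mixture of countably many of them is a
continuous measure for which sets of full measure are dense in every one of the Cantor sets
(\<open>continuous_circle_measure_charging_cantor_maps\<close>). Since the eigenvector fields are continuous, their
values over such a set have the same closed span as all their values.

The remaining implication, from spanning outside every countable set to Cantor sets, is the heart of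
the matter. The pairs of a unimodular eigenvalue and a unit eigenvector form a closed subset of the
separable complete metric space of pairs of a complex number and a vector.
Discarding the relatively open parts that involve only countably many eigenvalues loses, all in all,
only countably many eigenvalues (\<open>relative_perfect_kernel\<close>), and by hypothesis what is left is still
spanning. Every relatively open part of the remainder now involves uncountably many eigenvalues, and a
Cantor scheme that separates the eigenvalues at each step
(\<open>cantor_scheme_separated_by_map\<close>) produces inside it a Cantor set of eigenpairs that is the graph
of a continuous eigenvector field. Such fields, one for each member of a countable base, take values
near every remaining unit eigenvector, so together they span a dense subspace.\<close>

section \<open>Closed complex spans\<close>

lemma subspace_closure_cspan:
  "complex_vector.subspace (closure (cspan W :: 'a::complex_normed_vector set))"
proof (rule complex_vector.subspaceI)
  show "0 \<in> closure (cspan W)"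
    using complex_vector.span_zero closure_subset by blast
  fix x y :: 'a assume x: "x \<in> closure (cspan W)" and y: "y \<in> closure (cspan W)"
  obtain u where u: "\<And>n. u n \<in> cspan W" "u \<longlonglongrightarrow> x" using x closure_sequential by blast
  obtain v where v: "\<And>n. v n \<in> cspan W" "v \<longlonglongrightarrow> y" using y closure_sequential by blast
  have "(\<lambda>n. u n + v n) \<longlonglongrightarrow> x + y" using u v by (intro tendsto_add)
  then show "x + y \<in> closure (cspan W)"
    unfolding closure_sequential
    by (intro exI[of _ "\<lambda>n. u n + v n"]) (simp add: u(1) v(1) complex_vector.span_add)
next
  fix c :: complex and x :: 'a assume x: "x \<in> closure (cspan W)"
  show "c *\<^sub>C x \<in> closure (cspan W)"
    unfolding closure_approachable
  proof (intro allI impI)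
    fix e :: real assume "e > 0"
    then have "e / (cmod c + 1) > 0" by (simp add: add_nonneg_pos)
    then obtain y where y: "y \<in> cspan W" "dist y x < e / (cmod c + 1)"
      using x unfolding closure_approachable by blast
    have "dist (c *\<^sub>C y) (c *\<^sub>C x) = cmod c * dist y x"
      by (simp add: dist_norm norm_scaleC flip: complex_vector.scale_right_diff_distrib)
    also have "\<dots> \<le> (cmod c + 1) * dist y x" by (simp add: mult_right_mono)
    also have "\<dots> < e" using y(2) by (simp add: pos_less_divide_eq add_nonneg_pos mult.commute)
    finally show "\<exists>z\<in>cspan W. dist z (c *\<^sub>C x) < e"
      using y(1) complex_vector.span_scale by blast
  qed
qed

text \<open>Every density claim below is transferred by this principle: a set whose span is dense may be
replaced by any set whose closed span contains it.\<close>

lemma closure_cspan_minimal: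
  assumes "V \<subseteq> closure (cspan W)"
  shows "closure (cspan V) \<subseteq> closure (cspan W)"
  by (intro closure_minimal closed_closure complex_vector.span_minimal[OF assms subspace_closure_cspan])

lemma bounded_bilinear_scaleC:
  "bounded_bilinear (scaleC :: complex \<Rightarrow> 'a \<Rightarrow> 'a::complex_normed_vector)"
proof
  fix a b :: complex and x y :: 'a and r :: real
  show "(a + b) *\<^sub>C x = a *\<^sub>C x + b *\<^sub>C x" by (rule scaleC_add_left)
  show "a *\<^sub>C (x + y) = a *\<^sub>C x + a *\<^sub>C y" by (rule scaleC_add_right)
  show "(r *\<^sub>R a) *\<^sub>C x = r *\<^sub>R a *\<^sub>C x"
    by (simp add: scaleR_scaleC scaleC_scaleC scaleR_conv_of_real)
  show "a *\<^sub>C (r *\<^sub>R x) = r *\<^sub>R a *\<^sub>C x"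
    by (simp add: scaleR_scaleC scaleC_scaleC mult.commute)
  show "\<exists>K. \<forall>a (x::'a). norm (a *\<^sub>C x) \<le> norm a * norm x * K"
    by (intro exI[of _ 1]) (simp add: norm_scaleC)
qed

lemma bounded_clinear_bounded_linear:
  assumes "bounded_clinear T"
  shows "bounded_linear T"
proof -
  interpret T: Vector_Spaces.linear scaleC scaleC T
    using assms by (simp add: bounded_clinear_def)
  obtain M where M: "norm (T x) \<le> M * norm x" for x
    using assms unfolding bounded_clinear_def by blast
  show ?thesis
    by (rule bounded_linear_intro[where K = M])
       (use M in \<open>auto simp: T.add T.scale scaleR_scaleC mult.commute\<close>)
qed

section \<open>A continuous measure carried by countably many Cantor sets\<close>

definition cylinder :: "(nat \<Rightarrow> 'a) \<Rightarrow> nat \<Rightarrow> (nat \<Rightarrow> 'a) set" where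
  "cylinder x n = {y. \<forall>i<n. y i = x i}"

lemma self_in_cylinder: "x \<in> cylinder x n"
  by (simp add: cylinder_def)

lemma open_cylinder: "open (cylinder x n :: (nat \<Rightarrow> 'a::discrete_topology) set)"
proof -
  have "open {y. \<forall>i\<in>{..<n}. y (id i) \<in> {x i}}"
    by (intro product_topology_basis' finite_lessThan
        discrete_topology_class.open_discrete)
  moreover have "cylinder x n = {y. \<forall>i\<in>{..<n}. y (id i) \<in> {x i}}"
    by (auto simp: cylinder_def)
  ultimately show ?thesis by simp
qed

lemma cylinder_in_open:
  fixes x :: "nat \<Rightarrow> 'a::topological_space"
  assumes "open U" "x \<in> U"
  obtains n where "cylinder x n \<subseteq> U"
proof -
  have "openin (product_topology (\<lambda>i. euclidean) UNIV) U"
    using assms(1) by (simp add: open_fun_def)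
  from product_topology_open_contains_basis[OF this assms(2)]
  obtain X where X: "x \<in> (\<Pi>\<^sub>E i\<in>UNIV. X i)" "finite {i. X i \<noteq> UNIV}" "(\<Pi>\<^sub>E i\<in>UNIV. X i) \<subseteq> U"
    by auto
  obtain n where n: "\<And>i. X i \<noteq> UNIV \<Longrightarrow> i < n"
    using X(2) by (metis (mono_tags, lifting) finite_nat_set_iff_bounded mem_Collect_eq)
  have "cylinder x n \<subseteq> (\<Pi>\<^sub>E i\<in>UNIV. X i)"
  proof
    fix y assume "y \<in> cylinder x n"
    then have "y i \<in> X i" for i
      using X(1) n[of i] by (cases "X i = UNIV") (auto simp: cylinder_def PiE_iff)
    then show "y \<in> (\<Pi>\<^sub>E i\<in>UNIV. X i)" by auto
  qed
  then show thesis using X(3) by (intro that) (rule subset_trans)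
qed

text \<open>A cylinder depends only on finitely many coordinates of its centre, so over a countable alphabet
there are as many cylinders as finite words. This is what makes open subsets of the Cantor space
measurable for the product \<sigma>-algebra.\<close>

lemma countable_range_cylinder:
  "countable (range (case_prod cylinder) :: (nat \<Rightarrow> 'a::countable) set set)"
proof -
  have "range (case_prod cylinder) \<subseteq> range (\<lambda>w :: 'a list. {y. \<forall>i<length w. y i = w ! i})"
  proof (clarsimp simp: image_iff)
    fix x :: "nat \<Rightarrow> 'a" and n
    show "\<exists>w. cylinder x n = {y. \<forall>i<length w. y i = w ! i}"
      by (intro exI[of _ "map x [0..<n]"]) (simp add: cylinder_def)
  qed
  then show ?thesis by (rule countable_subset) simp
qed

abbreviation coin_tossing :: "(nat \<Rightarrow> bool) measure" where
  "coin_tossing \<equiv> PiM UNIV (\<lambda>_. measure_pmf (bernoulli_pmf (1/2)))"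

lemma prob_space_coin_tossing: "prob_space coin_tossing"
  by (intro prob_space_PiM measure_pmf.prob_space_axioms)

lemma sets_coin_tossing_cylinder [measurable]: "cylinder x n \<in> sets coin_tossing"
proof -
  have "cylinder x n = {y \<in> space coin_tossing. \<forall>i<n. y i = x i}"
    by (auto simp: cylinder_def space_PiM)
  also have "\<dots> \<in> sets coin_tossing" by measurable
  finally show ?thesis .
qed

lemma emeasure_cylinder: "emeasure coin_tossing (cylinder x n) = ennreal ((1/2) ^ n)"
proof -
  interpret product_prob_space "\<lambda>_::nat. measure_pmf (bernoulli_pmf (1/2))" UNIV
    by unfold_locales
  have "cylinder x n = {y \<in> space coin_tossing. \<forall>i\<in>{..<n}. y i \<in> {x i}}"
    by (auto simp: cylinder_def space_PiM)
  then have "emeasure coin_tossing (cylinder x n)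
      = (\<Prod>i<n. emeasure (measure_pmf (bernoulli_pmf (1/2))) {x i})"
    using emeasure_PiM_Collect[of "{..<n}" "\<lambda>i. {x i}"] by simp
  also have "\<dots> = (\<Prod>i<n. ennreal (1/2))"
    unfolding emeasure_pmf_single pmf_bernoulli_half ..
  also have "\<dots> = ennreal ((1/2) ^ n)"
    by (simp only: prod_constant card_lessThan ennreal_power)
  finally show ?thesis .
qed

lemma open_in_sets_coin_tossing:
  assumes "open U"
  shows "U \<in> sets coin_tossing"
proof -
  define \<C> where "\<C> = {C \<in> range (case_prod cylinder). C \<subseteq> U}"
  have "\<Union>\<C> = U"
  proof
    show "U \<subseteq> \<Union>\<C>"
    proof
      fix x assume "x \<in> U"
      then obtain n where "cylinder x n \<subseteq> U" using cylinder_in_open[OF assms] by blast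
      then have "cylinder x n \<in> \<C>" unfolding \<C>_def by (metis (mono_tags) case_prod_conv mem_Collect_eq rangeI)
      then show "x \<in> \<Union>\<C>" using self_in_cylinder by blast
    qed
  qed (auto simp: \<C>_def)
  moreover have "countable \<C>"
    using countable_range_cylinder by (rule countable_subset[rotated]) (auto simp: \<C>_def)
  moreover have "\<C> \<subseteq> sets coin_tossing" by (auto simp: \<C>_def)
  ultimately show ?thesis using sets.countable_Union[of \<C> coin_tossing] by simp
qed

lemma continuous_measurable_coin_tossing:
  fixes h :: "(nat \<Rightarrow> bool) \<Rightarrow> 'b::topological_space"
  assumes "continuous_on UNIV h"
  shows "h \<in> borel_measurable coin_tossing"
proof (rule borel_measurableI)
  fix S :: "'b set" assume "open S"
  then have "h -` S \<in> sets coin_tossing"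
    by (intro open_in_sets_coin_tossing open_vimage assms)
  then show "h -` S \<inter> space coin_tossing \<in> sets coin_tossing"
    by (simp add: space_PiM)
qed

lemma emeasure_coin_tossing_singleton: "emeasure coin_tossing {x} = 0"
proof -
  have "emeasure coin_tossing {x} \<le> ennreal ((1/2) ^ n)" for n
    using emeasure_mono[of "{x}" "cylinder x n" coin_tossing]
    by (simp add: emeasure_cylinder self_in_cylinder)
  moreover have "(\<lambda>n. ennreal ((1/2) ^ n)) \<longlonglongrightarrow> ennreal 0"
    by (rule tendsto_ennrealI) (simp add: LIMSEQ_realpow_zero)
  ultimately have "emeasure coin_tossing {x} \<le> ennreal 0"
    by (intro Lim_bounded2[where N = 0]) auto
  then show ?thesis by simp
qed

text \<open>The measure is a mixture, with strictly positive weights, of the images of the coin tossing measure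
under the maps \<^term>\<open>h i\<close>. Injectivity makes each image atomless, since a point of the
circle has at most one preimage. A null set of the mixture has null preimage under every
\<^term>\<open>h i\<close>, and a null set of the Cantor space contains no cylinder; thus the complement of a
null set is dense in each Cantor set, even though the Cantor sets may overlap.\<close>

lemma continuous_circle_measure_charging_cantor_maps:
  fixes h :: "nat \<Rightarrow> (nat \<Rightarrow> bool) \<Rightarrow> complex"
  assumes cont: "\<And>i. continuous_on UNIV (h i)" and inj: "\<And>i. inj (h i)"
    and range: "\<And>i. range (h i) \<subseteq> unit_circle"
  obtains \<sigma> where "continuous_circle_measure \<sigma>"
    and "\<forall>N\<in>null_sets \<sigma>. \<forall>i x n. \<exists>y\<in>cylinder x n. h i y \<notin> N"
proof
  define S where "S = restrict_space borel unit_circle"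
  \<comment> \<open>Any distribution on the naturals charging every point would do as weights.\<close>
  define p where "p = (geometric_pmf (1/2) :: nat pmf)"
  define \<sigma> where "\<sigma> = measure_pmf p \<bind> (\<lambda>i. distr coin_tossing S (h i))"
  have meas [measurable]: "h i \<in> measurable coin_tossing S" for i
    unfolding S_def using range[of i]
    by (intro measurable_restrict_space2 continuous_measurable_coin_tossing cont) auto
  have prob: "prob_space (distr coin_tossing S (h i))" for i
    by (intro prob_space.prob_space_distr prob_space_coin_tossing meas)
  have kernel: "(\<lambda>i. distr coin_tossing S (h i)) \<in> measurable (measure_pmf p) (subprob_algebra S)"
    using prob by (auto simp: space_subprob_algebra prob_space_imp_subprob_space)
  have sets: "sets \<sigma> = sets S" unfolding \<sigma>_def by (rule sets_bind[OF sets_kernel[OF kernel]]) auto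
  have em: "emeasure \<sigma> B = (\<integral>\<^sup>+i. emeasure coin_tossing (h i -` B) \<partial>measure_pmf p)"
    if "B \<in> sets S" for B
    unfolding \<sigma>_def
    by (subst emeasure_bind[OF _ kernel that])
       (use that in \<open>auto simp: emeasure_distr space_PiM\<close>)
  show "continuous_circle_measure \<sigma>"
    unfolding continuous_circle_measure_def
  proof (intro conjI ballI)
    show "prob_space \<sigma>"
      unfolding \<sigma>_def
      by (rule measure_pmf.prob_space_bind[OF _ kernel]) (simp add: prob)
    show "sets \<sigma> = sets (restrict_space borel unit_circle)"
      using sets by (simp add: S_def)
    fix \<mu> :: complex assume \<mu>: "\<mu> \<in> unit_circle"
    have "emeasure coin_tossing (h i -` {\<mu>}) = 0" for i
    proof (cases "\<mu> \<in> range (h i)")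
      case True
      then obtain x where "\<mu> = h i x" by blast
      then have "h i -` {\<mu>} = {x}" using inj[of i] by (auto dest: injD)
      then show ?thesis by (simp add: emeasure_coin_tossing_singleton)
    next
      case False
      then have "h i -` {\<mu>} = {}" by auto
      then show ?thesis by simp
    qed
    moreover have "{\<mu>} \<in> sets S" using \<mu> unfolding S_def by (subst sets_restrict_space_iff) auto
    ultimately show "emeasure \<sigma> {\<mu>} = 0" using em by simp
  qed
  show "\<forall>N\<in>null_sets \<sigma>. \<forall>i x n. \<exists>y\<in>cylinder x n. h i y \<notin> N"
  proof (intro ballI allI)
    fix N i x n assume N: "N \<in> null_sets \<sigma>"
    then have NS: "N \<in> sets S" using sets by auto
    have "(\<integral>\<^sup>+i. emeasure coin_tossing (h i -` N) \<partial>measure_pmf p) = 0"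
      using N em[OF NS] by auto
    then have "emeasure coin_tossing (h i -` N) = 0"
      by (subst (asm) nn_integral_0_iff_AE)
         (auto simp: AE_measure_pmf_iff p_def set_pmf_geometric)
    moreover have "h i -` N \<in> sets coin_tossing"
      using measurable_sets[OF meas NS] by (simp add: space_PiM)
    ultimately have "\<not> cylinder x n \<subseteq> h i -` N"
      using emeasure_mono[of "cylinder x n" "h i -` N" coin_tossing] emeasure_cylinder[of x n] by auto
    then show "\<exists>y\<in>cylinder x n. h i y \<notin> N" by auto
  qed
qed

section \<open>Cantor sets on which a map is injective\<close>

text \<open>A Cantor--Bendixson argument in which smallness of a set means countability of its image under
\<^term>\<open>f\<close>, not countability of the set itself: the basic open sets that meet \<^term>\<open>P\<close> in a
small set are removed. There are countably many of them, so the part removed is small, and therefore no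
open set that meets the remainder can meet it in a small set.\<close>

lemma relative_perfect_kernel:
  fixes P :: "'a::topological_space set" and f :: "'a \<Rightarrow> 'b"
  assumes "second_countable (euclidean :: 'a topology)" "closed P"
  obtains Q where "closed Q" "Q \<subseteq> P" "countable (f ` (P - Q))"
    and "\<And>U. open U \<Longrightarrow> U \<inter> Q \<noteq> {} \<Longrightarrow> uncountable (f ` (U \<inter> Q))"
proof -
  obtain \<B> :: "'a set set" where \<B>: "countable \<B>" "\<And>V. V \<in> \<B> \<Longrightarrow> open V"
    "\<And>U x. open U \<Longrightarrow> x \<in> U \<Longrightarrow> \<exists>V\<in>\<B>. x \<in> V \<and> V \<subseteq> U"
    using assms(1) unfolding second_countable_def by auto
  define small where "small = {V \<in> \<B>. countable (f ` (V \<inter> P))}"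
  have "countable small"
    using \<B>(1) by (rule countable_subset[rotated]) (auto simp: small_def)
  then have "countable (\<Union>V\<in>small. f ` (V \<inter> P))"
    by (rule countable_UN) (simp add: small_def)
  moreover have "f ` (P - (P - \<Union>small)) = (\<Union>V\<in>small. f ` (V \<inter> P))" by blast
  ultimately have removed: "countable (f ` (P - (P - \<Union>small)))" by simp
  show thesis
  proof
    show "closed (P - \<Union>small)"
      using assms(2) \<B>(2) by (intro closed_Diff open_Union) (auto simp: small_def)
    show "P - \<Union>small \<subseteq> P" by blast
    show "countable (f ` (P - (P - \<Union>small)))" by (rule removed)
    fix U assume U: "open U" "U \<inter> (P - \<Union>small) \<noteq> {}"
    then obtain x where x: "x \<in> U" "x \<in> P" "x \<notin> \<Union>small" by blast
    obtain V where V: "V \<in> \<B>" "x \<in> V" "V \<subseteq> U" using \<B>(3)[OF U(1) x(1)] by blast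
    then have unc: "uncountable (f ` (V \<inter> P))" using x by (auto simp: small_def)
    have "f ` (V \<inter> P) \<subseteq> f ` (U \<inter> (P - \<Union>small)) \<union> f ` (P - (P - \<Union>small))"
      using V(3) by blast
    then show "uncountable (f ` (U \<inter> (P - \<Union>small)))"
      using unc removed by (meson countable_Un countable_subset)
  qed
qed

lemma separate_into_two_balls:
  fixes f :: "'a::metric_space \<Rightarrow> 'b::t2_space"
  assumes "continuous_on P f" "open U" "p \<in> U \<inter> P" "q \<in> U \<inter> P" "f p \<noteq> f q" "\<delta> > 0"
  obtains r where "r > 0" "r \<le> \<delta>" "cball p r \<subseteq> U" "cball q r \<subseteq> U"
    "\<And>u v. u \<in> cball p r \<inter> P \<Longrightarrow> v \<in> cball q r \<inter> P \<Longrightarrow> f u \<noteq> f v"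
proof -
  obtain V W where VW: "open V" "open W" "f p \<in> V" "f q \<in> W" "V \<inter> W = {}"
    using hausdorff[OF assms(5)] by blast
  obtain V' where V': "open V'" "V' \<inter> P = f -` V \<inter> P"
    using assms(1) VW(1) unfolding continuous_on_open_invariant by blast
  obtain W' where W': "open W'" "W' \<inter> P = f -` W \<inter> P"
    using assms(1) VW(2) unfolding continuous_on_open_invariant by blast
  have "p \<in> U \<inter> V'" "q \<in> U \<inter> W'" using assms VW V' W' by blast+
  then obtain a b where a: "a > 0" "cball p a \<subseteq> U \<inter> V'" and b: "b > 0" "cball q b \<subseteq> U \<inter> W'"
    using assms(2) V'(1) W'(1) by (meson open_Int open_contains_cball)
  define r where "r = Min {a, b, \<delta>}"
  have r: "r > 0" "r \<le> \<delta>" "r \<le> a" "r \<le> b" using a b assms(6) by (auto simp: r_def)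
  have sub: "cball p r \<subseteq> U \<inter> V'" "cball q r \<subseteq> U \<inter> W'"
    using a b r subset_cball by blast+
  show thesis
  proof (rule that)
    show "r > 0" "r \<le> \<delta>" by (rule r)+
    show "cball p r \<subseteq> U" "cball q r \<subseteq> U" using sub by simp_all
    fix u v assume uv: "u \<in> cball p r \<inter> P" "v \<in> cball q r \<inter> P"
    have "u \<in> V' \<inter> P" using uv(1) sub(1) by auto
    then have "f u \<in> V" using V'(2) by auto
    moreover have "v \<in> W' \<inter> P" using uv(2) sub(2) by auto
    then have "f v \<in> W" using W'(2) by auto
    ultimately show "f u \<noteq> f v" using VW(5) by auto
  qed
qed

text \<open>The Cantor scheme with a twist: it is the images under \<^term>\<open>f\<close> of the two children of a ball,
and not only the children themselves, that are made disjoint. The limit map then stays injective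
after composition with \<^term>\<open>f\<close>. This replaces the perfect set theorem for the analytic set
\<open>f ` (U \<inter> P)\<close> and gives, in addition, a continuous choice of preimages.\<close>

lemma cantor_scheme_separated_by_map:
  fixes f :: "'a::complete_space \<Rightarrow> 'b::t2_space"
  assumes "closed P" "continuous_on P f"
    and rich: "\<And>U. open U \<Longrightarrow> U \<inter> P \<noteq> {} \<Longrightarrow> \<exists>p\<in>U \<inter> P. \<exists>q\<in>U \<inter> P. f p \<noteq> f q"
    and U: "open U" "U \<inter> P \<noteq> {}"
  obtains g :: "(nat \<Rightarrow> bool) \<Rightarrow> 'a"
  where "continuous_on UNIV g" "range g \<subseteq> U \<inter> P" "inj (f \<circ> g)"
proof -
  \<comment> \<open>A node of the tree is a ball, stored as its centre and radius.\<close>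
  define B :: "'a \<times> real \<Rightarrow> 'a set" where "B s = cball (fst s) (snd s)" for s
  define ok where "ok s \<longleftrightarrow> fst s \<in> P \<and> snd s > 0" for s :: "'a \<times> real"
  have "\<exists>t :: bool \<Rightarrow> 'a \<times> real. ok s \<longrightarrow>
      (\<forall>b. ok (t b) \<and> snd (t b) \<le> snd s / 2 \<and> B (t b) \<subseteq> B s) \<and>
      (\<forall>u\<in>B (t True) \<inter> P. \<forall>v\<in>B (t False) \<inter> P. f u \<noteq> f v)" for s
  proof (cases "ok s")
    case True
    then have s: "fst s \<in> P" "snd s > 0" by (auto simp: ok_def)
    obtain p q where pq: "p \<in> ball (fst s) (snd s) \<inter> P" "q \<in> ball (fst s) (snd s) \<inter> P" "f p \<noteq> f q"
    proof -
      have "fst s \<in> ball (fst s) (snd s) \<inter> P" using s by simp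
      then show thesis using rich[OF open_ball] that by blast
    qed
    obtain r where r: "r > 0" "r \<le> snd s / 2" "cball p r \<subseteq> ball (fst s) (snd s)"
      "cball q r \<subseteq> ball (fst s) (snd s)"
      "\<And>u v. u \<in> cball p r \<inter> P \<Longrightarrow> v \<in> cball q r \<inter> P \<Longrightarrow> f u \<noteq> f v"
      using separate_into_two_balls[OF assms(2) open_ball pq, of "snd s / 2"] s(2) by auto
    have "cball p r \<subseteq> cball (fst s) (snd s)" "cball q r \<subseteq> cball (fst s) (snd s)"
      using r(3,4) ball_subset_cball by blast+
    then show ?thesis
      using r pq by (intro exI[of _ "\<lambda>b. (if b then p else q, r)"]) (simp add: ok_def B_def)
  qed blast
  then obtain child :: "'a \<times> real \<Rightarrow> bool \<Rightarrow> 'a \<times> real" where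
    child: "\<And>s b. ok s \<Longrightarrow> ok (child s b) \<and> snd (child s b) \<le> snd s / 2 \<and> B (child s b) \<subseteq> B s" and
    apart: "\<And>s u v. ok s \<Longrightarrow> u \<in> B (child s True) \<inter> P \<Longrightarrow> v \<in> B (child s False) \<inter> P \<Longrightarrow> f u \<noteq> f v"
    by metis
  obtain p where "p \<in> U" "p \<in> P" using U(2) by blast
  then obtain r where r: "r > 0" "cball p r \<subseteq> U" using U(1) open_contains_cball by blast
  \<comment> \<open>\<^term>\<open>node x n\<close> is reached by the first \<^term>\<open>n\<close> choices of the branch \<^term>\<open>x\<close>.\<close>
  define node where "node x n = rec_nat (p, r) (\<lambda>n s. child s (x n)) n"
    for x :: "nat \<Rightarrow> bool" and n
  have node_0: "node x 0 = (p, r)" and node_Suc: "node x (Suc n) = child (node x n) (x n)" for x n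
    by (simp_all add: node_def)
  have ok: "ok (node x n)" for x n
    by (induction n) (use r \<open>p \<in> P\<close> child in \<open>auto simp: node_0 node_Suc ok_def\<close>)
  have radius: "snd (node x n) \<le> r * (1/2) ^ n" for x n
  proof (induction n)
    case (Suc n)
    then show ?case using child[OF ok, of x n "x n"] by (auto simp: node_Suc)
  qed (simp add: node_0)
  have small: "\<exists>n. \<forall>x. 2 * snd (node x n) < e" if "e > 0" for e
  proof -
    have "\<exists>n. (1/2::real) ^ n < e / (2 * r)"
      by (rule real_arch_pow_inv) (use r(1) that in auto)
    then obtain n where "(1/2::real) ^ n < e / (2 * r)" by blast
    then have n: "2 * (r * (1/2) ^ n) < e"
      using r(1) by (simp add: field_simps)
    have "2 * snd (node x n) < e" for x
      using radius[of x n] n by linarith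
    then show ?thesis by blast
  qed
  have diam: "dist u v \<le> 2 * snd (node x n)" if "u \<in> B (node x n)" "v \<in> B (node x n)" for u v x n
    using that dist_triangle3[of u v "fst (node x n)"] by (auto simp: B_def)
  have "\<exists>a. \<forall>n. a \<in> B (node x n) \<inter> P" for x
  proof -
    have "\<exists>a. \<Inter>(range (\<lambda>n. B (node x n) \<inter> P)) = {a}"
    proof (rule decreasing_closed_nest_sing)
      show "closed (B (node x n) \<inter> P)" for n using assms(1) by (auto simp: B_def)
      show "B (node x n) \<inter> P \<noteq> {}" for n
      proof -
        have "fst (node x n) \<in> B (node x n) \<inter> P" using ok[of x n] by (simp add: B_def ok_def)
        then show ?thesis by blast
      qed
      have "B (node x n) \<subseteq> B (node x m)" if "m \<le> n" for m n
        using lift_Suc_antimono_le[of "\<lambda>n. B (node x n)" m n] child[OF ok] that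
        by (simp add: node_Suc)
      then show "B (node x n) \<inter> P \<subseteq> B (node x m) \<inter> P" if "m \<le> n" for m n
        using that by blast
      show "\<exists>n. \<forall>u\<in>B (node x n) \<inter> P. \<forall>v\<in>B (node x n) \<inter> P. dist u v < e" if "e > 0" for e
      proof -
        obtain n where n: "2 * snd (node x n) < e" using small[OF \<open>e > 0\<close>] by blast
        have "dist u v < e" if "u \<in> B (node x n)" "v \<in> B (node x n)" for u v
          using diam[OF that] n by simp
        then show ?thesis by blast
      qed
    qed
    then show ?thesis by blast
  qed
  then obtain g where g: "\<And>x n. g x \<in> B (node x n) \<inter> P" by metis
  have prefix: "node y n = node x n" if "y \<in> cylinder x n" for x y n
    using that by (induction n) (auto simp: cylinder_def node_0 node_Suc)
  show thesis
  proof
    show "continuous_on UNIV g"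
      unfolding continuous_on_topological
    proof (intro ballI allI impI)
      fix x V assume V: "open V" "g x \<in> V"
      then obtain e where e: "e > 0" "ball (g x) e \<subseteq> V" using open_contains_ball by blast
      obtain n where n: "2 * snd (node x n) < e" using small[OF e(1)] by blast
      have "g y \<in> V" if "y \<in> cylinder x n" for y
      proof -
        have "dist (g x) (g y) \<le> 2 * snd (node x n)"
          using g[of x n] g[of y n] prefix[OF that] by (intro diam) auto
        then show ?thesis using n e(2) by (auto simp: subset_iff)
      qed
      then show "\<exists>A. open A \<and> x \<in> A \<and> (\<forall>y\<in>UNIV. y \<in> A \<longrightarrow> g y \<in> V)"
        by (intro exI[of _ "cylinder x n"] conjI open_cylinder self_in_cylinder) blast
    qed
    have "g x \<in> U \<inter> P" for x
      using g[of x 0] r(2) by (auto simp: node_0 B_def)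
    then show "range g \<subseteq> U \<inter> P" by blast
    have aux: "f (g x) \<noteq> f (g y)" if "\<forall>i<n. y i = x i" "x n" "\<not> y n" for x y n
    proof -
      have "node y n = node x n" using that(1) by (intro prefix) (simp add: cylinder_def)
      then show ?thesis
        using apart[OF ok, of "g x" x n "g y"] g[of x "Suc n"] g[of y "Suc n"] that(2,3)
        by (simp add: node_Suc)
    qed
    show "inj (f \<circ> g)"
    proof (rule injI, rule ccontr)
      fix x y assume eq: "(f \<circ> g) x = (f \<circ> g) y" and "x \<noteq> y"
      then have ex: "\<exists>n. x n \<noteq> y n" by auto
      \<comment> \<open>Where two branches first differ, they pass to the two children of one node.\<close>
      define n where "n = (LEAST n. x n \<noteq> y n)"
      have n: "x n \<noteq> y n" unfolding n_def by (rule LeastI_ex[OF ex])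
      have agree: "x i = y i" if "i < n" for i
        using not_less_Least[of i "\<lambda>n. x n \<noteq> y n"] that by (simp add: n_def)
      show False
      proof (cases "x n")
        case True
        then show False using aux[of n y x] agree n eq by simp
      next
        case False
        then show False using aux[of n x y] agree n eq by simp
      qed
    qed
  qed
qed

lemma compact_UNIV_cantor: "compact (UNIV :: (nat \<Rightarrow> bool) set)"
proof -
  have "compact_space (euclidean :: bool topology)"
    by (simp add: compact_space_def finite_imp_compact)
  then have "compact_space (product_topology (\<lambda>i::nat. euclidean :: bool topology) UNIV)"
    by (simp add: compact_space_product_topology)
  then show ?thesis
    by (simp add: euclidean_product_topology compact_space_def)
qed

text \<open>The relative perfect kernel needs a countable base rather than a countable dense set; in a metric space
the balls of radius \<open>1 / Suc n\<close> about the points of the dense set form one.\<close>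

lemma second_countable_of_countable_dense:
  fixes C :: "'a::metric_space set"
  assumes "countable C" "closure C = UNIV"
  shows "second_countable (euclidean :: 'a topology)"
  unfolding second_countable_def
proof (intro exI conjI ballI allI impI)
  let ?\<B> = "(\<lambda>(c, n). ball c (1 / Suc n)) ` (C \<times> UNIV)"
  show "countable ?\<B>" using assms(1) by (intro countable_image countable_SIGMA) auto
  show "openin euclidean V" if "V \<in> ?\<B>" for V using that by auto
  fix U :: "'a set" and x assume U: "openin euclidean U \<and> x \<in> U"
  then obtain e where e: "e > 0" "ball x e \<subseteq> U" by (auto simp: open_contains_ball)
  obtain n where n: "1 / Suc n < e / 2" using e(1) nat_approx_posE[of "e/2"] by auto
  have "x \<in> closure C" using assms(2) by simp
  then obtain c where c: "c \<in> C" "dist c x < 1 / Suc n"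
    unfolding closure_approachable by (metis of_nat_0_less_iff zero_less_Suc zero_less_divide_1_iff)
  have "ball c (1 / Suc n) \<subseteq> ball x e"
  proof
    fix y assume "y \<in> ball c (1 / Suc n)"
    then show "y \<in> ball x e"
      using c n dist_triangle3[of x y c] by (simp add: dist_commute)
  qed
  then show "\<exists>V\<in>?\<B>. x \<in> V \<and> V \<subseteq> U"
    using c e(2) by (intro bexI[of _ "ball c (1 / Suc n)"]) auto
qed

lemma second_countable_complex_times:
  assumes "separable_space (euclidean :: 'a::metric_space topology)"
  shows "second_countable (euclidean :: (complex \<times> 'a) topology)"
proof -
  obtain C :: "'a set" where C: "countable C" "closure C = UNIV"
    using assms by (auto simp: separable_space_def)
  obtain D :: "complex set" where D: "countable D" "UNIV \<subseteq> closure D"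
    by (rule separable[of UNIV])
  have "closure (D \<times> C) = UNIV" using C D by (auto simp: closure_Times)
  then show ?thesis using C D by (intro second_countable_of_countable_dense) auto
qed

section \<open>The three conditions on eigenvectors\<close>

definition countably_robust_span :: "('a::complex_normed_vector \<Rightarrow> 'a) \<Rightarrow> bool" where
  "countably_robust_span T \<longleftrightarrow>
     (\<forall>D. countable D \<and> D \<subseteq> unit_circle \<longrightarrow>
        closure (cspan (\<Union>\<mu>\<in>unit_circle - D. eigenspace T \<mu>)) = UNIV)"

definition spanning_cantor_eigenfields :: "('a::complex_normed_vector \<Rightarrow> 'a) \<Rightarrow> bool" where
  "spanning_cantor_eigenfields T \<longleftrightarrow>
     (\<exists>(K :: nat \<Rightarrow> complex set) (E :: nat \<Rightarrow> complex \<Rightarrow> 'a).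
        (\<forall>i\<ge>1. K i \<subseteq> unit_circle \<and> K i homeomorphic (UNIV :: (nat \<Rightarrow> bool) set) \<and>
           continuous_on (K i) (E i) \<and> E i ` K i \<subseteq> sphere 0 1 \<and>
           (\<forall>\<mu>\<in>K i. T (E i \<mu>) = \<mu> *\<^sub>C E i \<mu>)) \<and>
        closure (cspan {E i \<mu> |i \<mu>. i \<ge> 1 \<and> \<mu> \<in> K i}) = UNIV)"

text \<open>A continuous measure does not see countable sets, so the complement of a countable set has full
measure.\<close>

lemma perfectly_spanning_imp_countably_robust:
  assumes "perfectly_spanning T"
  shows "countably_robust_span T"
  unfolding countably_robust_span_def
proof (intro allI impI)
  fix D :: "complex set" assume D: "countable D \<and> D \<subseteq> unit_circle"
  obtain \<sigma> where \<sigma>: "continuous_circle_measure \<sigma>"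
    and full: "\<And>A. A \<in> sets (completion \<sigma>) \<Longrightarrow> emeasure (completion \<sigma>) A = 1 \<Longrightarrow>
           closure (cspan (\<Union>\<mu>\<in>A. eigenspace T \<mu>)) = UNIV"
    using assms unfolding perfectly_spanning_def by blast
  interpret prob_space \<sigma> using \<sigma> by (simp add: continuous_circle_measure_def)
  have sets: "sets \<sigma> = sets (restrict_space borel unit_circle)"
    using \<sigma> by (simp add: continuous_circle_measure_def)
  have space: "space \<sigma> = unit_circle"
    using sets_eq_imp_space_eq[OF sets] by (simp add: space_restrict_space)
  have "D = (\<Union>\<mu>\<in>D. {\<mu>})" by simp
  also have "\<dots> \<in> null_sets \<sigma>"
  proof (rule null_sets_UN')
    show "countable D" using D by simp
    fix \<mu> assume "\<mu> \<in> D"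
    then have \<mu>: "\<mu> \<in> unit_circle" using D by blast
    then have "{\<mu>} \<in> sets \<sigma>" unfolding sets by (subst sets_restrict_space_iff) auto
    then show "{\<mu>} \<in> null_sets \<sigma>" using \<sigma> \<mu> by (auto simp: continuous_circle_measure_def)
  qed
  finally have null: "D \<in> null_sets \<sigma>" .
  then have "unit_circle - D \<in> sets \<sigma>" using sets.compl_sets[of D \<sigma>] by (auto simp: space)
  moreover have "emeasure \<sigma> (unit_circle - D) = 1"
    using emeasure_Diff_null_set[OF null, of "space \<sigma>"] sets.top[of \<sigma>]
    by (simp add: space emeasure_space_1[unfolded space])
  ultimately show "closure (cspan (\<Union>\<mu>\<in>unit_circle - D. eigenspace T \<mu>)) = UNIV"
    by (intro full) (auto intro: sets_completionI_sets)
qed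

text \<open>For the mixture constructed above, a set of full measure meets each Cantor set in a dense subset. By
continuity of the eigenvector fields, the eigenvectors over that subset already approximate all
values of the fields.\<close>

lemma spanning_cantor_eigenfields_imp_perfectly_spanning:
  assumes "spanning_cantor_eigenfields T"
  shows "perfectly_spanning T"
proof -
  obtain K and E :: "nat \<Rightarrow> complex \<Rightarrow> 'a" where
    fields: "\<forall>i\<ge>1. K i \<subseteq> unit_circle \<and> K i homeomorphic (UNIV :: (nat \<Rightarrow> bool) set) \<and>
           continuous_on (K i) (E i) \<and> E i ` K i \<subseteq> sphere 0 1 \<and>
           (\<forall>\<mu>\<in>K i. T (E i \<mu>) = \<mu> *\<^sub>C E i \<mu>)"
    and dense: "closure (cspan {E i \<mu> |i \<mu>. i \<ge> 1 \<and> \<mu> \<in> K i}) = UNIV"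
    using assms unfolding spanning_cantor_eigenfields_def by (elim exE conjE)
  have KE: "K i \<subseteq> unit_circle \<and> K i homeomorphic (UNIV :: (nat \<Rightarrow> bool) set) \<and>
           continuous_on (K i) (E i) \<and> (\<forall>\<mu>\<in>K i. T (E i \<mu>) = \<mu> *\<^sub>C E i \<mu>)"
    if "i \<ge> 1" for i
    using fields that by simp
  \<comment> \<open>The maps are indexed from 0, the Cantor sets from 1: \<^term>\<open>h i\<close> parametrizes \<^term>\<open>K (Suc i)\<close>.\<close>
  have "\<exists>h :: (nat \<Rightarrow> bool) \<Rightarrow> complex.
      continuous_on UNIV h \<and> inj h \<and> range h = K (Suc i)" for i
  proof -
    have "(UNIV :: (nat \<Rightarrow> bool) set) homeomorphic K (Suc i)"
      using KE[of "Suc i"] homeomorphic_sym by auto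
    then obtain h k where "homeomorphism (UNIV :: (nat \<Rightarrow> bool) set) (K (Suc i)) h k"
      unfolding homeomorphic_def by blast
    then show ?thesis
      by (intro exI[of _ h]) (auto simp: homeomorphism_def intro: inj_on_inverseI)
  qed
  then obtain h :: "nat \<Rightarrow> (nat \<Rightarrow> bool) \<Rightarrow> complex" where
    h: "\<And>i. continuous_on UNIV (h i)" "\<And>i. inj (h i)" "\<And>i. range (h i) = K (Suc i)"
    by metis
  have h_circle: "range (h i) \<subseteq> unit_circle" for i
    using h(3)[of i] KE[of "Suc i"] by simp
  obtain \<sigma> where \<sigma>: "continuous_circle_measure \<sigma>"
    and charged: "\<forall>N\<in>null_sets \<sigma>. \<forall>i x n. \<exists>y\<in>cylinder x n. h i y \<notin> N"
    by (rule continuous_circle_measure_charging_cantor_maps[where h = h, OF h(1,2) h_circle])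
  interpret prob_space \<sigma> using \<sigma> by (simp add: continuous_circle_measure_def)
  have space: "space \<sigma> = unit_circle"
    using \<sigma> sets_eq_imp_space_eq[of \<sigma> "restrict_space borel unit_circle"]
    by (simp add: continuous_circle_measure_def space_restrict_space)
  interpret completion: prob_space "completion \<sigma>"
    by (rule prob_space_completion)
  show ?thesis
    unfolding perfectly_spanning_def
  proof (intro exI[of _ \<sigma>] conjI \<sigma> ballI impI)
    \<comment> \<open>A set of the completion with full measure contains the complement of a Borel null set.\<close>
    fix A assume A: "A \<in> sets (completion \<sigma>)" "emeasure (completion \<sigma>) A = 1"
    have "unit_circle - A \<in> null_sets (completion \<sigma>)"
      using A completion.prob_compl[of A] sets.compl_sets[OF A(1)] space
      by (auto simp: null_sets_def completion.emeasure_eq_measure)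
    then obtain N where N: "N \<in> null_sets \<sigma>" "unit_circle - A \<subseteq> N"
      unfolding null_sets_completion_iff2 by (elim bexE)
    let ?W = "\<Union>\<mu>\<in>A. eigenspace T \<mu>"
    have "E (Suc i) (h i x) \<in> closure (cspan ?W)" for i x
    proof -
      have cont: "continuous_on UNIV (E (Suc i) \<circ> h i)"
        using h(1,3)[of i] KE[of "Suc i"] by (intro continuous_on_compose) auto
      show ?thesis
        unfolding closure_approachable
      proof (intro allI impI)
        fix e :: real assume "e > 0"
        let ?V = "(E (Suc i) \<circ> h i) -` ball (E (Suc i) (h i x)) e"
        have "open ?V" by (intro open_vimage open_ball cont)
        then obtain n where n: "cylinder x n \<subseteq> ?V"
          using cylinder_in_open[of ?V x] \<open>e > 0\<close> by auto
        obtain y where y: "y \<in> cylinder x n" "h i y \<notin> N" using charged N(1) by blast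
        have "h i y \<in> K (Suc i)" using h(3)[of i] by blast
        then have "h i y \<in> A" "T (E (Suc i) (h i y)) = h i y *\<^sub>C E (Suc i) (h i y)"
          using y(2) N(2) KE[of "Suc i"] by auto
        then have "E (Suc i) (h i y) \<in> ?W" by (auto simp: eigenspace_def)
        then have "E (Suc i) (h i y) \<in> cspan ?W" by (rule complex_vector.span_base)
        moreover have "dist (E (Suc i) (h i y)) (E (Suc i) (h i x)) < e"
          using n y(1) by (auto simp: dist_commute)
        ultimately show "\<exists>z\<in>cspan ?W. dist z (E (Suc i) (h i x)) < e" by blast
      qed
    qed
    moreover have "\<exists>j x. i = Suc j \<and> \<mu> = h j x" if "i \<ge> 1" "\<mu> \<in> K i" for i \<mu>
      using that h(3)[of "i - 1"] by (intro exI[of _ "i - 1"]) (auto simp: image_iff)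
    ultimately have "{E i \<mu> |i \<mu>. i \<ge> 1 \<and> \<mu> \<in> K i} \<subseteq> closure (cspan ?W)"
      by fastforce
    then show "closure (cspan ?W) = UNIV"
      using closure_cspan_minimal dense by blast
  qed
qed

lemma closed_unit_eigenpairs:
  fixes T :: "'a::complex_normed_vector \<Rightarrow> 'a"
  assumes "bounded_clinear T"
  shows "closed {(\<mu>, x). cmod \<mu> = 1 \<and> norm x = 1 \<and> T x = \<mu> *\<^sub>C x}"
proof -
  have T: "continuous_on UNIV (\<lambda>p :: complex \<times> 'a. T (snd p))"
    by (intro bounded_linear.continuous_on[OF bounded_clinear_bounded_linear[OF assms]] continuous_intros)
  have sc: "continuous_on UNIV (\<lambda>p :: complex \<times> 'a. fst p *\<^sub>C snd p)"
    by (intro bounded_bilinear.continuous_on[OF bounded_bilinear_scaleC] continuous_intros)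
  have "closed {p :: complex \<times> 'a. cmod (fst p) = 1 \<and> norm (snd p) = 1 \<and> T (snd p) = fst p *\<^sub>C snd p}"
    by (intro closed_Collect_conj closed_Collect_eq T sc continuous_intros)
  then show ?thesis by (simp add: case_prod_beta')
qed

text \<open>Apply the Cantor scheme to the first projection: on the resulting Cantor set of eigenpairs the
eigenvalue determines the pair, and by compactness it does so continuously. The second coordinate is
then an eigenvector field over the Cantor set of eigenvalues.\<close>

lemma cantor_eigenfield_in_open:
  fixes T :: "'a::complex_banach \<Rightarrow> 'a" and Q :: "(complex \<times> 'a) set"
  assumes "closed Q" and eig: "Q \<subseteq> {(\<mu>, x). cmod \<mu> = 1 \<and> norm x = 1 \<and> T x = \<mu> *\<^sub>C x}"
    and unc: "\<And>U. open U \<Longrightarrow> U \<inter> Q \<noteq> {} \<Longrightarrow> uncountable (fst ` (U \<inter> Q))"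
    and U: "open U" "U \<inter> Q \<noteq> {}"
  obtains K and E :: "complex \<Rightarrow> 'a"
  where "K \<subseteq> unit_circle" "K homeomorphic (UNIV :: (nat \<Rightarrow> bool) set)" "continuous_on K E"
    "E ` K \<subseteq> sphere 0 1" "\<And>\<mu>. \<mu> \<in> K \<Longrightarrow> T (E \<mu>) = \<mu> *\<^sub>C E \<mu>"
    "\<And>\<mu>. \<mu> \<in> K \<Longrightarrow> (\<mu>, E \<mu>) \<in> U" "K \<noteq> {}"
proof -
  have rich: "\<exists>p\<in>V \<inter> Q. \<exists>q\<in>V \<inter> Q. fst p \<noteq> fst q" if V: "open V" "V \<inter> Q \<noteq> {}" for V
  proof (rule ccontr)
    assume "\<not> ?thesis"
    then have eq: "fst p = fst q" if "p \<in> V \<inter> Q" "q \<in> V \<inter> Q" for p q using that by blast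
    obtain p where "p \<in> V \<inter> Q" using V(2) by blast
    then have "fst ` (V \<inter> Q) \<subseteq> {fst p}" using eq by blast
    then have "countable (fst ` (V \<inter> Q))" by (rule countable_subset) simp
    then show False using unc[OF V] by contradiction
  qed
  obtain g :: "(nat \<Rightarrow> bool) \<Rightarrow> complex \<times> 'a" where
    g: "continuous_on UNIV g" "range g \<subseteq> U \<inter> Q" "inj (fst \<circ> g)"
    by (rule cantor_scheme_separated_by_map[where f = fst,
        OF assms(1) continuous_on_fst[OF continuous_on_id] rich U])
  define K where "K = range (fst \<circ> g)"
  have "continuous_on UNIV (fst \<circ> g)"
    by (intro continuous_on_compose g(1) continuous_on_fst continuous_on_id)
  then obtain k where k: "homeomorphism UNIV K (fst \<circ> g) k"
    using homeomorphism_compact[OF compact_UNIV_cantor _ _ g(3), of K] K_def by blast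
  define E where "E \<mu> = snd (g (k \<mu>))" for \<mu>
  have "continuous_on K (g \<circ> k)"
    using k g(1) continuous_on_subset by (intro continuous_on_compose) (auto simp: homeomorphism_def)
  then have cont: "continuous_on K E"
    unfolding E_def comp_def by (rule continuous_on_snd)
  have pair: "(\<mu>, E \<mu>) = g (k \<mu>)" if "\<mu> \<in> K" for \<mu>
    using homeomorphism_apply2[OF k that] by (simp add: E_def prod_eq_iff)
  have inUQ: "(\<mu>, E \<mu>) \<in> U \<inter> Q" if "\<mu> \<in> K" for \<mu>
    unfolding pair[OF that] using g(2) by blast
  have inP: "cmod \<mu> = 1 \<and> norm (E \<mu>) = 1 \<and> T (E \<mu>) = \<mu> *\<^sub>C E \<mu>" if "\<mu> \<in> K" for \<mu>
    using inUQ[OF that] eig by auto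
  show thesis
  proof (rule that)
    show "K \<subseteq> unit_circle" "E ` K \<subseteq> sphere 0 1" using inP by auto
    show "K homeomorphic (UNIV :: (nat \<Rightarrow> bool) set)"
      using k homeomorphic_sym unfolding homeomorphic_def by blast
    show "K \<noteq> {}" by (simp add: K_def)
  qed (use cont inP inUQ in auto)
qed

text \<open>Let \<^term>\<open>P\<close> be the set of eigenpairs with unimodular eigenvalue and unit eigenvector, and
\<^term>\<open>Q\<close> its perfect kernel relative to the eigenvalue. Only countably many eigenvalues occur
in \<^term>\<open>P - Q\<close>, so the hypothesis, applied to those, shows that the eigenvectors occurring in
\<^term>\<open>Q\<close> still span a dense subspace. One eigenvector field inside each basic open set that
meets \<^term>\<open>Q\<close> is enough to approximate all these eigenvectors.\<close>

lemma countably_robust_imp_spanning_cantor_eigenfields: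
  fixes T :: "'a::complex_banach \<Rightarrow> 'a"
  assumes sep: "separable_space (euclidean :: 'a topology)"
    and nontrivial: "\<exists>x :: 'a. x \<noteq> 0"
    and T: "bounded_clinear T"
    and robust: "countably_robust_span T"
  shows "spanning_cantor_eigenfields T"
proof -
  define P where "P = {(\<mu>, x). cmod \<mu> = 1 \<and> norm x = 1 \<and> T x = \<mu> *\<^sub>C x}"
  interpret T: Vector_Spaces.linear scaleC scaleC T
    using T by (simp add: bounded_clinear_def)
  have sc: "second_countable (euclidean :: (complex \<times> 'a) topology)"
    by (rule second_countable_complex_times[OF sep])
  have "closed P" unfolding P_def by (rule closed_unit_eigenpairs[OF T])
  from relative_perfect_kernel[OF sc this, where f = fst]
  obtain Q where Q: "closed Q" "Q \<subseteq> P" "countable (fst ` (P - Q))"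
    "\<And>U. open U \<Longrightarrow> U \<inter> Q \<noteq> {} \<Longrightarrow> uncountable (fst ` (U \<inter> Q))" by blast
  define D where "D = fst ` (P - Q)"
  have "D \<subseteq> unit_circle" by (auto simp: D_def P_def)
  then have dense: "closure (cspan (\<Union>\<mu>\<in>unit_circle - D. eigenspace T \<mu>)) = UNIV"
    using robust Q(3) by (auto simp: countably_robust_span_def D_def)
  have normalized: "(\<mu>, complex_of_real (1 / norm x) *\<^sub>C x) \<in> Q"
    if "\<mu> \<in> unit_circle - D" "x \<in> eigenspace T \<mu>" "x \<noteq> 0" for \<mu> x
  proof -
    have "(\<mu>, complex_of_real (1 / norm x) *\<^sub>C x) \<in> P"
      using that by (simp add: P_def eigenspace_def T.scale norm_scaleC norm_divide scaleC_scaleC mult.commute)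
    then show ?thesis using that(1) by (force simp: D_def)
  qed
  have in_span: "x \<in> cspan (snd ` Q)" if "\<mu> \<in> unit_circle - D" "x \<in> eigenspace T \<mu>" for \<mu> x
  proof (cases "x = 0")
    case False
    let ?u = "complex_of_real (1 / norm x) *\<^sub>C x"
    have "?u \<in> snd ` Q" using normalized[OF that False] by force
    then have "complex_of_real (norm x) *\<^sub>C ?u \<in> cspan (snd ` Q)"
      by (intro complex_vector.span_scale complex_vector.span_base)
    then show ?thesis using False by (simp add: scaleC_scaleC scaleC_one)
  qed (simp add: complex_vector.span_zero)
  have denseQ: "closure (cspan (snd ` Q)) = UNIV"
  proof -
    have "(\<Union>\<mu>\<in>unit_circle - D. eigenspace T \<mu>) \<subseteq> closure (cspan (snd ` Q))"
      using in_span closure_subset by blast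
    then show ?thesis using closure_cspan_minimal dense by blast
  qed
  have "Q \<noteq> {}"
  proof
    assume "Q = {}"
    then have "closure (cspan (snd ` Q)) = {0}" by simp
    then show False using denseQ nontrivial by auto
  qed
  obtain \<B> :: "(complex \<times> 'a) set set" where \<B>: "countable \<B>" "\<And>V. V \<in> \<B> \<Longrightarrow> open V"
    "\<And>U x. open U \<Longrightarrow> x \<in> U \<Longrightarrow> \<exists>V\<in>\<B>. x \<in> V \<and> V \<subseteq> U"
    using sc unfolding second_countable_def by auto
  define \<F> where "\<F> = {V \<in> \<B>. V \<inter> Q \<noteq> {}}"
  have "countable \<F>" using \<B>(1) by (rule countable_subset[rotated]) (auto simp: \<F>_def)
  have "\<F> \<noteq> {}" using \<open>Q \<noteq> {}\<close> \<B>(3)[OF open_UNIV] unfolding \<F>_def by fastforce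
  have fields: "\<exists>K E. K \<subseteq> unit_circle \<and> K homeomorphic (UNIV :: (nat \<Rightarrow> bool) set) \<and>
      continuous_on K E \<and> E ` K \<subseteq> sphere 0 1 \<and> (\<forall>\<mu>\<in>K. T (E \<mu>) = \<mu> *\<^sub>C E \<mu>) \<and>
      (\<forall>\<mu>\<in>K. (\<mu>, E \<mu>) \<in> V) \<and> K \<noteq> {}" if "V \<in> \<F>" for V
  proof -
    have V: "open V" "V \<inter> Q \<noteq> {}" using that \<B>(2) by (auto simp: \<F>_def)
    obtain K and E :: "complex \<Rightarrow> 'a" where "K \<subseteq> unit_circle"
      "K homeomorphic (UNIV :: (nat \<Rightarrow> bool) set)" "continuous_on K E"
      "E ` K \<subseteq> sphere 0 1" "\<forall>\<mu>\<in>K. T (E \<mu>) = \<mu> *\<^sub>C E \<mu>"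
      "\<forall>\<mu>\<in>K. (\<mu>, E \<mu>) \<in> V" "K \<noteq> {}"
      using cantor_eigenfield_in_open[OF Q(1) Q(2)[unfolded P_def] Q(4) V, of thesis] by simp
    then show ?thesis by (intro exI[of _ K] exI[of _ E]) simp
  qed
  \<comment> \<open>The shift by one makes the indices from 1 onwards already exhaust \<^term>\<open>\<F>\<close>.\<close>
  define V where "V n = from_nat_into \<F> (n - 1)" for n
  have "V n \<in> \<F>" for n unfolding V_def by (rule from_nat_into[OF \<open>\<F> \<noteq> {}\<close>])
  then have "\<forall>n. \<exists>K E. K \<subseteq> unit_circle \<and> K homeomorphic (UNIV :: (nat \<Rightarrow> bool) set) \<and>
      continuous_on K E \<and> E ` K \<subseteq> sphere 0 1 \<and> (\<forall>\<mu>\<in>K. T (E \<mu>) = \<mu> *\<^sub>C E \<mu>) \<and>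
      (\<forall>\<mu>\<in>K. (\<mu>, E \<mu>) \<in> V n) \<and> K \<noteq> {}"
    using fields by blast
  then obtain K E where KE: "\<And>n. K n \<subseteq> unit_circle \<and> K n homeomorphic (UNIV :: (nat \<Rightarrow> bool) set) \<and>
      continuous_on (K n) (E n) \<and> E n ` K n \<subseteq> sphere 0 1 \<and> (\<forall>\<mu>\<in>K n. T (E n \<mu>) = \<mu> *\<^sub>C E n \<mu>) \<and>
      (\<forall>\<mu>\<in>K n. (\<mu>, E n \<mu>) \<in> V n) \<and> K n \<noteq> {}"
    by metis
  let ?S = "{E i \<mu> |i \<mu>. i \<ge> 1 \<and> \<mu> \<in> K i}"
  have "snd p \<in> closure (cspan ?S)" if "p \<in> Q" for p
    unfolding closure_approachable
  proof (intro allI impI)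
    fix e :: real assume "e > 0"
    obtain W where W: "W \<in> \<B>" "p \<in> W" "W \<subseteq> ball p e"
      using \<B>(3)[of "ball p e" p] \<open>e > 0\<close> by auto
    then have "W \<in> \<F>" using that by (auto simp: \<F>_def)
    then obtain m where "from_nat_into \<F> m = W"
      using from_nat_into_surj[OF \<open>countable \<F>\<close>] by blast
    then have "V (Suc m) = W" by (simp add: V_def)
    then obtain n where n: "n \<ge> 1" "V n = W" by force
    obtain \<mu> where \<mu>: "\<mu> \<in> K n" using KE[of n] by blast
    then have "(\<mu>, E n \<mu>) \<in> ball p e" using KE[of n] n W(3) by blast
    then have "dist (E n \<mu>) (snd p) < e"
      using dist_snd_le[of "(\<mu>, E n \<mu>)" p] by (simp add: dist_commute)
    moreover have "E n \<mu> \<in> cspan ?S"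
      using \<mu> n(1) by (intro complex_vector.span_base) auto
    ultimately show "\<exists>y\<in>cspan ?S. dist y (snd p) < e" by blast
  qed
  then have "snd ` Q \<subseteq> closure (cspan ?S)" by blast
  then have "closure (cspan ?S) = UNIV" using closure_cspan_minimal denseQ by blast
  then show ?thesis
    unfolding spanning_cantor_eigenfields_def using KE by (intro exI[of _ K] exI[of _ E]) auto
qed

theorem theorem4p1:
  fixes T :: "'a::complex_banach \<Rightarrow> 'a"
  assumes "separable_space (euclidean :: 'a topology)"
    and "infinite_cdim TYPE('a)"
    and "bounded_clinear T"
  shows "((\<forall>D. countable D \<and> D \<subseteq> unit_circle \<longrightarrow>
             closure (cspan (\<Union>\<mu>\<in>unit_circle - D. eigenspace T \<mu>)) = UNIV)
          \<longleftrightarrow> perfectly_spanning T)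
       \<and> (perfectly_spanning T \<longleftrightarrow>
          (\<exists>(K :: nat \<Rightarrow> complex set) (E :: nat \<Rightarrow> complex \<Rightarrow> 'a).
             (\<forall>i\<ge>1. K i \<subseteq> unit_circle \<and> K i homeomorphic (UNIV :: (nat \<Rightarrow> bool) set) \<and>
                continuous_on (K i) (E i) \<and> E i ` K i \<subseteq> sphere 0 1 \<and>
                (\<forall>\<mu>\<in>K i. T (E i \<mu>) = \<mu> *\<^sub>C E i \<mu>)) \<and>
             closure (cspan {E i \<mu> |i \<mu>. i \<ge> 1 \<and> \<mu> \<in> K i}) = UNIV))"
proof -
  have "\<exists>x :: 'a. x \<noteq> 0"
  proof (rule ccontr)
    assume "\<not> (\<exists>x :: 'a. x \<noteq> 0)"
    then have "cspan {} = (UNIV :: 'a set)" by auto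
    then show False using assms(2) unfolding infinite_cdim_def by blast
  qed
  then have "(countably_robust_span T \<longleftrightarrow> perfectly_spanning T) \<and>
      (perfectly_spanning T \<longleftrightarrow> spanning_cantor_eigenfields T)"
    using perfectly_spanning_imp_countably_robust[of T]
      spanning_cantor_eigenfields_imp_perfectly_spanning[of T]
      countably_robust_imp_spanning_cantor_eigenfields[OF assms(1) _ assms(3)]
    by blast
  then show ?thesis
    unfolding countably_robust_span_def spanning_cantor_eigenfields_def .
qed

end
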